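(* Let $\Vdash$ be any of the following three non-monotonic proof-theoretic consequence relations: $\models$ (standard base semantics), $\models^{\alpha}$ (reducibility semantics), $\models^{s}$ (Sandqvist's base semantics). Then intuitionistic propositional logic $\mathrm{IL}$ is not base-complete over $\Vdash$; that is, it is not the case that for all finite sets of formulas $\Gamma$, all formulas $A$ and all atomic bases $\mathfrak{B}$, $\Gamma \Vdash_{\mathfrak{B}} A$ implies $\Gamma \vdash_{\mathrm{IL} \cup \mathfrak{B}} A$.
   Context: **Language.** Formulas: $X ::= p, q, r, s, t, \ldots \mid \bot \mid X \wedge X \mid X \vee X \mid X \rightarrow X$, with $\neg X := X \rightarrow \bot$. Atomic formulas (atoms) are the propositional variables and $\bot$ (an atomic constant for absurdity). $\Gamma$ always denotes a finite set of formulas. **Atomic bases.** Every atom is an atomic rule of level $0$. Given atoms $A_1,\ldots,A_n$ and (possibly empty) finite sets of atomic rules $\mathfrak{C}_1,\ldots,\mathfrak{C}_n$, where the rules "from $\mathfrak{C}_i$ infer $A_i$" have maximal level $k-1$ (if $\mathfrak{C}_i=\emptyset$, this is just the atom $A_i$, of level $0$), and given an atom $A$, the rule with premises $A_1,\ldots,A_n$, conclusion $A$, and discharging $\mathfrak{C}_i$ above the $i$-th premise, is an atomic rule of level $k$. An atomic base of level $k$ is a set of atomic rules of maximal level $k$; there is no upper bound on the admitted levels $k$. Derivations are the usual natural deduction trees: an atom $A$ is derivable from a set of rules $\mathfrak{S}$ when some rule in $\mathfrak{S}$ has conclusion $A$ and each premise $A_i$ of it is derivable from $\mathfrak{S} \cup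 \mathfrak{C}_i$, $\mathfrak{C}_i$ being the set of rules discharged at that premise (an atom in $\mathfrak{S}$ is derivable outright). $\mathrm{DER}_{\mathfrak{B}}$ is the set of derivations over $\mathfrak{B}$, and $\vdash_{\mathfrak{B}} A$ means that $A$ is derivable from $\mathfrak{B}$. All atomic bases $\mathfrak{B}$ are assumed consistent: $\not\vdash_{\mathfrak{B}} \bot$. **Derivability in $\mathrm{IL}$ with a base.** $\Gamma \vdash_{\mathrm{IL} \cup \mathfrak{B}} A$ means that $A$ is derivable from assumptions $\Gamma$ by natural deduction derivations using the rules of intuitionistic propositional logic together with the atomic rules of $\mathfrak{B}$ (with $\mathrm{IL} \cup \emptyset = \mathrm{IL}$). **Standard base semantics.** $\Gamma \models_{\mathfrak{B}} A$ is defined by: if $\Gamma = \emptyset$, then for $A$ atomic, $\models_{\mathfrak{B}} A$ iff $\vdash_{\mathfrak{B}} A$; $\models_{\mathfrak{B}} B \wedge C$ iff $\models_{\mathfrak{B}} B$ and $\models_{\mathfrak{B}} C$; $\models_{\mathfrak{B}} B \vee C$ iff $\models_{\mathfrak{B}} B$ or $\models_{\mathfrak{B}} C$; $\models_{\mathfrak{B}} B \rightarrow C$ iff $B \models_{\mathfrak{B}} C$. If $\Gamma \neq \emptyset$, then $\Gamma \models_{\mathfrak{B}} A$ iff ($\models_{\mathfrak{B}} B$ for all $B \in \Gamma$ implies $\models_{\mathfrak{B}} A$). **Sandqvist's base semantics (non-monotonic).** $\models^{s}_{\mathfrak{B}}$ is defined by the same clauses as $\models_{\mathfrak{B}}$ (with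 $\models^{s}_{\mathfrak{B}}$ in place of $\models_{\mathfrak{B}}$ throughout), except that $\models^{s}_{\mathfrak{B}} A \vee B$ iff for every atom $C$ (if $A \models^{s}_{\mathfrak{B}} C$ and $B \models^{s}_{\mathfrak{B}} C$, then $\models^{s}_{\mathfrak{B}} C$). **Reducibility semantics.** An *argument structure* is a pair $\mathscr{D} = \langle T, f\rangle$ where $T$ is a finite rooted tree with order relation $\omega$, with nodes labelled by formulas and top-nodes partitioned into axiomatic and non-axiomatic ones; $f$ is a discharge function, mapping onto lower nodes elements of (a) a subset of the non-axiomatic top-nodes, (b) a subset of the axiomatic top-nodes labelled by atoms, (c) a subset of $\wp(\omega)$, each element of which contains only the pairs linking a node labelled by an atom to all its children, labelled by atoms too, with no non-axiomatic top-node mapped by $f$ onto such a maximal node or onto the image of the latter under $f$ (so $f$ indicates where assumptions, atomic axioms and atomic rules are discharged). The non-axiomatic top-nodes are the assumptions, the root is the conclusion. $\mathscr{D}$ is *closed* if the domain of $f$ contains all non-axiomatic top-nodes, otherwise *open*; it is *from* $\Gamma$ *to* (or *for* ) $A$ when $\Gamma$ is its set of undischarged assumptions and $A$ its conclusion. (Immediate) sub-structures, and the replacement $\mathscr{D}[\mathscr{D}^{**}/\mathscr{D}^{*}]$ of a sub-structure $\mathscr{D}^{*}$ by $\mathscr{D}^{**}$, are defined as usual. If $\mathscr{D}$ is from $\{A_1,\ldots,A_n\}$ to $A$ and $\sigma$ maps formulas to argument structures so that $\sigma(A_i)$ is a (closed) argument structure for $A_i$, then $\mathscr{D}^{\sigma}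 = \mathscr{D}[\sigma(A_1),\ldots,\sigma(A_n)/A_1,\ldots,A_n]$ is a (closed) *instance* of $\mathscr{D}$. An *inference* is a triple $\langle\langle \mathscr{D}_1,\ldots,\mathscr{D}_n\rangle, A, \delta\rangle$ ($n \ge 0$) with $\delta$ an extension of the discharge functions of the $\mathscr{D}_i$; its associated argument structure joins the trees of the $\mathscr{D}_i$ by a new root $A$, with discharges as given by $\delta$. An *inference rule* is a set of inferences. $\mathscr{D}$ is *canonical* iff it is associated to an instance of one of Gentzen's introduction rules for $\wedge,\vee,\rightarrow$. A *reduction* for a rule $R$ is a function $\phi$ from and to argument structures, defined on some subset $\mathbb{D}$ of $R$, such that for every $\mathscr{D}$ associated to an element of $\mathbb{D}$ and every $\sigma$: (1) the instance of $R$ to which $\mathscr{D}^{\sigma}$ is associated is in $\mathbb{D}$; (2) $\phi$ is defined on $\mathscr{D}^{\sigma}$ and $\phi(\mathscr{D}^{\sigma}) = \phi(\mathscr{D})^{\sigma}$; (3) if $\mathscr{D}$ is from $\Gamma$ to $A$, then $\phi(\mathscr{D})$ is from some $\Gamma^{*} \subseteq \Gamma$ to $A$. No constructivity or schematicity restriction is put on reductions. $\mathfrak{J}$ denotes a set of reductions; an extension of it is any set of reductions $\mathfrak{J}^{+} \supseteq \mathfrak{J}$. $\mathscr{D}$ *immediately reduces* to $\mathscr{D}^{*}$ via $\mathfrak{J}$ iff for some sub-structure $\mathscr{D}^{**}$ of $\mathscr{D}$ and some $\phi \in \mathfrak{J}$, $\mathscr{D}^{*} = \mathscr{D}[\phi(\mathscr{D}^{**})/\mathscr{D}^{**}]$;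 $\leq_{\mathfrak{J}}$ is the reflexive-transitive closure of this relation. An *argument* is a pair $\langle \mathscr{D}, \mathfrak{J}\rangle$, closed or open as $\mathscr{D}$ is. *Validity on* $\mathfrak{B}$ of $\langle \mathscr{D}, \mathfrak{J}\rangle$: if $\mathscr{D}$ is closed with atomic conclusion, it is valid iff $\mathscr{D} \leq_{\mathfrak{J}} \mathscr{D}^{*}$ for some $\mathscr{D}^{*} = \langle T,f\rangle$ with $T \in \mathrm{DER}_{\mathfrak{B}}$; if $\mathscr{D}$ is closed with non-atomic conclusion, it is valid iff $\mathscr{D} \leq_{\mathfrak{J}} \mathscr{D}^{*}$ for some canonical $\mathscr{D}^{*}$ whose immediate sub-structures are valid on $\mathfrak{B}$ when paired with $\mathfrak{J}$; if $\mathscr{D}$ is open with undischarged assumptions $A_1,\ldots,A_n$, it is valid iff for every $\sigma$ and every extension $\mathfrak{J}^{+}$ of $\mathfrak{J}$, if each $\langle \sigma(A_i), \mathfrak{J}^{+}\rangle$ ($i \le n$) is closed and valid on $\mathfrak{B}$, then $\langle \mathscr{D}^{\sigma}, \mathfrak{J}^{+}\rangle$ is valid on $\mathfrak{B}$. $\Gamma \models^{\alpha}_{\mathfrak{B}} A$ iff there is an argument $\langle \mathscr{D}, \mathfrak{J}\rangle$ from $\Gamma$ to $A$ valid on $\mathfrak{B}$. *)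

theory Defs
  imports "HOL-Library.FSet" "HOL-Library.Sublist"
begin

datatype atom = Var nat | Bot

datatype fm = Atom atom | And fm fm | Or fm fm | Imp fm fm

definition is_atomic :: "fm \<Rightarrow> bool" where
  "is_atomic A \<longleftrightarrow> (\<exists>a. A = Atom a)"

text \<open>
  \<open>ARule [(C\<^sub>1, a\<^sub>1), \<dots>, (C\<^sub>n, a\<^sub>n)] a\<close> infers \<open>a\<close> from \<open>a\<^sub>1, \<dots>, a\<^sub>n\<close>, discharging the rules in \<open>C\<^sub>i\<close> above
  the \<open>i\<close>-th premise. The atom \<open>a\<close>, viewed as an atomic rule, is \<open>ARule [] a\<close>.
\<close>
datatype arule = ARule (prems: "(arule fset \<times> atom) list") (conc: atom)

definition level_above :: "nat set \<Rightarrow> nat" where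
  "level_above N = (if N = {} then 0 else Suc (Max N))"

text \<open>
  The inner \<open>level_above\<close> is the level of the rule ``from \<open>C\<^sub>i\<close> infer \<open>a\<^sub>i\<close>'' (0 if \<open>C\<^sub>i\<close> is empty), the
  outer one the level of the whole rule.
\<close>
primrec level :: "arule \<Rightarrow> nat" where
  "level (ARule ps a) =
     level_above (set (map (\<lambda>(L, _). level_above (fset L)) (map (map_prod (fimage level) id) ps)))"

inductive der :: "arule set \<Rightarrow> atom \<Rightarrow> bool" where
  "ARule ps a \<in> S \<Longrightarrow> (\<And>C b. (C, b) \<in> set ps \<Longrightarrow> der (S \<union> fset C) b) \<Longrightarrow> der S a"

definition atomic_base :: "arule set \<Rightarrow> bool" where
  "atomic_base \<BB> \<longleftrightarrow> (\<exists>k. \<forall>r\<in>\<BB>. level r \<le> k) \<and> \<not> der \<BB> Bot"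


inductive il :: "arule set \<Rightarrow> fm set \<Rightarrow> fm \<Rightarrow> bool" where
  Assumption: "A \<in> \<Gamma> \<Longrightarrow> il S \<Gamma> A"
| AndI: "il S \<Gamma> A \<Longrightarrow> il S \<Gamma> B \<Longrightarrow> il S \<Gamma> (And A B)"
| AndE1: "il S \<Gamma> (And A B) \<Longrightarrow> il S \<Gamma> A"
| AndE2: "il S \<Gamma> (And A B) \<Longrightarrow> il S \<Gamma> B"
| OrI1: "il S \<Gamma> A \<Longrightarrow> il S \<Gamma> (Or A B)"
| OrI2: "il S \<Gamma> B \<Longrightarrow> il S \<Gamma> (Or A B)"
| OrE: "il S \<Gamma> (Or A B) \<Longrightarrow> il S (insert A \<Gamma>) C \<Longrightarrow> il S (insert B \<Gamma>) C \<Longrightarrow> il S \<Gamma> C"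
| ImpI: "il S (insert A \<Gamma>) B \<Longrightarrow> il S \<Gamma> (Imp A B)"
| ImpE: "il S \<Gamma> (Imp A B) \<Longrightarrow> il S \<Gamma> A \<Longrightarrow> il S \<Gamma> B"
| BotE: "il S \<Gamma> (Atom Bot) \<Longrightarrow> il S \<Gamma> A"
| AtomicRule: "ARule ps a \<in> S \<Longrightarrow>
    (\<And>C b. (C, b) \<in> set ps \<Longrightarrow> il (S \<union> fset C) \<Gamma> (Atom b)) \<Longrightarrow> il S \<Gamma> (Atom a)"


primrec std_valid :: "arule set \<Rightarrow> fm \<Rightarrow> bool" where
  "std_valid \<BB> (Atom a) \<longleftrightarrow> der \<BB> a"
| "std_valid \<BB> (And A B) \<longleftrightarrow> std_valid \<BB> A \<and> std_valid \<BB> B"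
| "std_valid \<BB> (Or A B) \<longleftrightarrow> std_valid \<BB> A \<or> std_valid \<BB> B"
| "std_valid \<BB> (Imp A B) \<longleftrightarrow> (std_valid \<BB> A \<longrightarrow> std_valid \<BB> B)"

definition std_conseq :: "arule set \<Rightarrow> fm set \<Rightarrow> fm \<Rightarrow> bool" where
  "std_conseq \<BB> \<Gamma> A \<longleftrightarrow> ((\<forall>B\<in>\<Gamma>. std_valid \<BB> B) \<longrightarrow> std_valid \<BB> A)"


text \<open>Sandqvist's semantics. In the clause for \<open>Or\<close>, validity of the atom \<open>c\<close> is unfolded to \<open>der \<BB> c\<close>.\<close>
primrec sq_valid :: "arule set \<Rightarrow> fm \<Rightarrow> bool" where
  "sq_valid \<BB> (Atom a) \<longleftrightarrow> der \<BB> a"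
| "sq_valid \<BB> (And A B) \<longleftrightarrow> sq_valid \<BB> A \<and> sq_valid \<BB> B"
| "sq_valid \<BB> (Or A B) \<longleftrightarrow>
     (\<forall>c. (sq_valid \<BB> A \<longrightarrow> der \<BB> c) \<and> (sq_valid \<BB> B \<longrightarrow> der \<BB> c) \<longrightarrow> der \<BB> c)"
| "sq_valid \<BB> (Imp A B) \<longleftrightarrow> (sq_valid \<BB> A \<longrightarrow> sq_valid \<BB> B)"

definition sq_conseq :: "arule set \<Rightarrow> fm set \<Rightarrow> fm \<Rightarrow> bool" where
  "sq_conseq \<BB> \<Gamma> A \<longleftrightarrow> ((\<forall>B\<in>\<Gamma>. sq_valid \<BB> B) \<longrightarrow> sq_valid \<BB> A)"


text \<open>
  \<open>Assm A\<close> is a non-axiomatic top-node, \<open>Inf A []\<close> an axiomatic one. Nodes are addressed by their path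
  from the root, so that \<open>y\<close> is lower than \<open>x\<close> iff \<open>strict_prefix y x\<close>.
\<close>
datatype tree = Assm (label: fm) | Inf (label: fm) (children: "tree list")
  where "children (Assm _) = []"

type_synonym pos = "nat list"

primrec subtree :: "tree \<Rightarrow> pos \<Rightarrow> tree option" where
  "subtree t [] = Some t"
| "subtree t (i # p) = (if i < length (children t) then subtree (children t ! i) p else None)"

text \<open>
  A discharge function maps positions to positions. As an argument of it, a top-node stands for itself
  and an inner node for the application of an atomic rule at that node, i.e. for the set of pairs
  linking it to all its children; that set is determined by its lowest node.
\<close>
type_synonym discharge = "pos \<rightharpoonup> pos"
type_synonym argstr = "tree \<times> discharge"

definition concl :: "argstr \<Rightarrow> fm" where
  "concl D = label (fst D)"

definition assm_onto :: "argstr \<Rightarrow> pos \<Rightarrow> bool" where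
  "assm_onto D y \<longleftrightarrow> (\<exists>x A. subtree (fst D) x = Some (Assm A) \<and> snd D x = Some y)"

text \<open>What can be discharged at a node: an assumption, or the application of an atomic axiom or rule.\<close>
datatype item = AssmItem fm | AtomicItem fm "fm list"

definition item :: "argstr \<Rightarrow> pos \<rightharpoonup> item" where
  "item D x = (case subtree (fst D) x of
     None \<Rightarrow> None
   | Some (Assm A) \<Rightarrow> Some (AssmItem A)
   | Some (Inf A ts) \<Rightarrow>
       if is_atomic A \<and> (\<forall>t\<in>set ts. is_atomic (label t)) \<and> (ts \<noteq> [] \<longrightarrow> \<not> assm_onto D x)
       then Some (AtomicItem A (map label ts)) else None)"

definition arg_struct :: "argstr \<Rightarrow> bool" where
  "arg_struct D \<longleftrightarrow>
     (\<forall>x y. snd D x = Some y \<longrightarrow>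
        strict_prefix y x \<and>
        item D x \<noteq> None \<and>
        (\<forall>A Bs. item D x = Some (AtomicItem A Bs) \<and> Bs \<noteq> [] \<longrightarrow> \<not> assm_onto D y))"

definition open_leaf :: "argstr \<Rightarrow> pos \<Rightarrow> bool" where
  "open_leaf D x \<longleftrightarrow> (\<exists>A. subtree (fst D) x = Some (Assm A)) \<and> snd D x = None"

definition closed_str :: "argstr \<Rightarrow> bool" where
  "closed_str D \<longleftrightarrow> (\<forall>x A. subtree (fst D) x = Some (Assm A) \<longrightarrow> x \<in> dom (snd D))"

definition assms_of :: "argstr \<Rightarrow> fm set" where
  "assms_of D = {A. \<exists>x. subtree (fst D) x = Some (Assm A) \<and> snd D x = None}"

definition from_to :: "argstr \<Rightarrow> fm set \<Rightarrow> fm \<Rightarrow> bool" where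
  "from_to D \<Gamma> A \<longleftrightarrow> arg_struct D \<and> assms_of D = \<Gamma> \<and> concl D = A"

definition sub :: "argstr \<Rightarrow> pos \<Rightarrow> argstr" where
  "sub D x = (the (subtree (fst D) x),
     \<lambda>p. case snd D (x @ p) of
           None \<Rightarrow> None
         | Some q \<Rightarrow> if prefix x q then Some (drop (length x) q) else None)"

primrec replace_tree :: "pos \<Rightarrow> tree \<Rightarrow> tree \<Rightarrow> tree" where
  "replace_tree [] s t = s"
| "replace_tree (i # p) s t =
     Inf (label t) ((children t)[i := replace_tree p s (children t ! i)])"

text \<open>
  \<open>D'\<close> results from \<open>D\<close> by replacing the sub-structure at \<open>x\<close> by \<open>E\<close>. An item that is undischarged in
  \<open>E\<close> is treated in \<open>D'\<close> as some item of the same form that was undischarged in the replaced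
  sub-structure was treated in \<open>D\<close>. As occurrences of the same form can be discharged at different
  nodes below \<open>x\<close>, this is a relation.
\<close>
definition replacement :: "argstr \<Rightarrow> pos \<Rightarrow> argstr \<Rightarrow> argstr \<Rightarrow> bool" where
  "replacement D x E D' \<longleftrightarrow>
     fst D' = replace_tree x (fst E) (fst D) \<and>
     (\<forall>p. \<not> prefix x p \<longrightarrow> snd D' p = snd D p) \<and>
     (\<forall>p q. snd E p = Some q \<longrightarrow> snd D' (x @ p) = Some (x @ q)) \<and>
     (\<forall>p. snd E p = None \<longrightarrow>
        (let M = {snd D (x @ q) | q.
                    item E p \<noteq> None \<and> item (sub D x) q = item E p \<and> snd (sub D x) q = None}
         in if M = {} then snd D' (x @ p) = None else snd D' (x @ p) \<in> M))"

text \<open>\<open>U\<close> marks the undischarged leaves.\<close>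
function subst_tree :: "(pos \<Rightarrow> bool) \<Rightarrow> (fm \<Rightarrow> tree) \<Rightarrow> tree \<Rightarrow> tree" where
  "subst_tree U s (Assm A) = (if U [] then s A else Assm A)"
| "subst_tree U s (Inf A ts) =
     Inf A (map (\<lambda>i. subst_tree (\<lambda>p. U (i # p)) s (ts ! i)) [0..<length ts])"
  by pat_completeness auto
termination
  by (relation "Wellfounded.measure (\<lambda>(U, s, t). size t)")
    (simp_all add: less_Suc_eq_le size_list_estimation'[OF nth_mem])

definition inst :: "argstr \<Rightarrow> (fm \<Rightarrow> argstr) \<Rightarrow> argstr" where
  "inst D \<sigma> =
     (subst_tree (\<lambda>x. snd D x = None) (fst \<circ> \<sigma>) (fst D),
      \<lambda>p. case find (open_leaf D) (prefixes p) of
            None \<Rightarrow> snd D p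
          | Some x \<Rightarrow> map_option ((@) x)
              (snd (\<sigma> (label (the (subtree (fst D) x)))) (drop (length x) p)))"

definition assignment_for :: "argstr \<Rightarrow> (fm \<Rightarrow> argstr) \<Rightarrow> bool" where
  "assignment_for D \<sigma> \<longleftrightarrow> (\<forall>A\<in>assms_of D. arg_struct (\<sigma> A) \<and> concl (\<sigma> A) = A)"


type_synonym inference = "argstr list \<times> fm \<times> discharge"

fun assoc :: "inference \<Rightarrow> argstr" where
  "assoc (Ds, A, \<delta>) = (Inf A (map fst Ds), \<delta>)"

text \<open>
  The last condition says that \<open>\<delta>\<close> extends the discharge functions of the \<open>Ds\<close>, with everything that is
  newly discharged being discharged at the new root.
\<close>
fun is_inference :: "inference \<Rightarrow> bool" where
  "is_inference (Ds, A, \<delta>) \<longleftrightarrow>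
     (\<forall>D\<in>set Ds. arg_struct D) \<and> arg_struct (assoc (Ds, A, \<delta>)) \<and>
     (\<forall>i<length Ds. sub (assoc (Ds, A, \<delta>)) [i] = Ds ! i)"

definition is_rule :: "inference set \<Rightarrow> bool" where
  "is_rule R \<longleftrightarrow> (\<forall>I\<in>R. is_inference I)"

definition and_intro :: "inference set" where
  "and_intro = {([D1, D2], And (concl D1) (concl D2), \<delta>) | D1 D2 \<delta>.
     is_inference ([D1, D2], And (concl D1) (concl D2), \<delta>) \<and> (\<forall>x. \<delta> x \<noteq> Some [])}"

definition or_intro :: "inference set" where
  "or_intro = {([D], Or A B, \<delta>) | D A B \<delta>.
     is_inference ([D], Or A B, \<delta>) \<and> concl D \<in> {A, B} \<and> (\<forall>x. \<delta> x \<noteq> Some [])}"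

definition imp_intro :: "inference set" where
  "imp_intro = {([D], Imp A (concl D), \<delta>) | D A \<delta>.
     is_inference ([D], Imp A (concl D), \<delta>) \<and>
     (\<forall>x. \<delta> x = Some [] \<longrightarrow> subtree (Inf (Imp A (concl D)) [fst D]) x = Some (Assm A))}"

definition canonical :: "argstr \<Rightarrow> bool" where
  "canonical D \<longleftrightarrow> (\<exists>I \<in> and_intro \<union> or_intro \<union> imp_intro. D = assoc I)"

type_synonym reduction = "argstr \<rightharpoonup> argstr"

definition reduction_for :: "inference set \<Rightarrow> reduction \<Rightarrow> bool" where
  "reduction_for R \<phi> \<longleftrightarrow> (\<exists>\<DD>. \<DD> \<subseteq> R \<and> dom \<phi> = assoc ` \<DD> \<and>
     (\<forall>D \<in> assoc ` \<DD>.
        (\<forall>\<sigma>. assignment_for D \<sigma> \<longrightarrow>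
           (\<exists>I\<in>\<DD>. assoc I = inst D \<sigma>) \<and> \<phi> (inst D \<sigma>) = Some (inst (the (\<phi> D)) \<sigma>)) \<and>
        (\<exists>\<Gamma>\<subseteq>assms_of D. from_to (the (\<phi> D)) \<Gamma> (concl D))))"

definition reductions :: "reduction set \<Rightarrow> bool" where
  "reductions J \<longleftrightarrow> (\<forall>\<phi>\<in>J. \<exists>R. is_rule R \<and> reduction_for R \<phi>)"

definition imm_reduces :: "reduction set \<Rightarrow> argstr \<Rightarrow> argstr \<Rightarrow> bool" where
  "imm_reduces J D D' \<longleftrightarrow>
     (\<exists>x \<phi> E. subtree (fst D) x \<noteq> None \<and> \<phi> \<in> J \<and> \<phi> (sub D x) = Some E \<and> replacement D x E D')"

definition reduces :: "reduction set \<Rightarrow> argstr \<Rightarrow> argstr \<Rightarrow> bool" where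
  "reduces J = (imm_reduces J)\<^sup>*\<^sup>*"


text \<open>
  \<open>\<rho> x\<close> is the rule applied at the node \<open>x\<close>. It belongs to the base, unless its application is discharged
  at some \<open>y\<close>, in which case it is one of the rules that \<open>\<rho> y\<close> discharges above the premise through
  which \<open>x\<close> is reached. The discharge function thus records the discharges of the derivation.
\<close>
definition DER :: "arule set \<Rightarrow> argstr set" where
  "DER \<BB> = {D. \<exists>\<rho>. \<forall>x t. subtree (fst D) x = Some t \<longrightarrow>
     t = Inf (Atom (conc (\<rho> x))) (children t) \<and>
     map label (children t) = map (Atom \<circ> snd) (prems (\<rho> x)) \<and>
     (case snd D x of
        None \<Rightarrow> \<rho> x \<in> \<BB>
      | Some y \<Rightarrow> (\<exists>i < length (prems (\<rho> y)).
          prefix (y @ [i]) x \<and> \<rho> x |\<in>| fst (prems (\<rho> y) ! i)))}"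

text \<open>
  The lemmas up to \<open>canonical_measure\<close> are needed only for the termination of \<open>valid\<close>: reduction and
  instantiation preserve closedness and conclusions, and the immediate sub-structures of a closed
  canonical structure are less complex.
\<close>

lemma subtree_append:
  "subtree t (x @ y) = (case subtree t x of None \<Rightarrow> None | Some s \<Rightarrow> subtree s y)"
  by (induction x arbitrary: t) auto

lemma subtree_Assm: "subtree (Assm A) y = Some s \<Longrightarrow> y = [] \<and> s = Assm A"
  by (cases y) auto

lemma finite_leaves: "finite {A. \<exists>x. subtree t x = Some (Assm A)}"
proof (induction t)
  case (Assm B)
  have "{A. \<exists>x. subtree (Assm B) x = Some (Assm A)} \<subseteq> {B}"
    by (auto dest: subtree_Assm)
  then show ?case by (rule finite_subset) simp
next
  case (Inf B ts)
  have "{A. \<exists>x. subtree (Inf B ts) x = Some (Assm A)}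
      \<subseteq> (\<Union>s\<in>set ts. {A. \<exists>x. subtree s x = Some (Assm A)})"
  proof clarify
    fix A x assume "subtree (Inf B ts) x = Some (Assm A)"
    then show "A \<in> (\<Union>s\<in>set ts. {A. \<exists>x. subtree s x = Some (Assm A)})"
      by (cases x) (auto split: if_splits)
  qed
  then show ?case by (rule finite_subset) (use Inf in auto)
qed

lemma finite_assms_of: "finite (assms_of D)"
  by (rule finite_subset[OF _ finite_leaves[of "fst D"]]) (auto simp: assms_of_def)

lemma closed_str_iff: "closed_str D \<longleftrightarrow> assms_of D = {}"
  by (auto simp: closed_str_def assms_of_def dom_def)

lemma label_replace_tree:
  "subtree t x = Some u \<Longrightarrow> label s = label u \<Longrightarrow> label (replace_tree x s t) = label t"
  by (cases x) auto

lemma subtree_replace_tree: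
  assumes "subtree t x \<noteq> None" "subtree (replace_tree x s t) p = Some (Assm A)"
  shows "(\<exists>y. p = x @ y \<and> subtree s y = Some (Assm A)) \<or>
    (\<not> prefix x p \<and> subtree t p = Some (Assm A))"
  using assms
proof (induction x arbitrary: t p)
  case Nil
  then show ?case by simp
next
  case (Cons i x)
  have i: "i < length (children t)" "subtree (children t ! i) x \<noteq> None"
    using Cons.prems(1) by (auto split: if_splits)
  obtain j q where p: "p = j # q"
    using Cons.prems(2) by (cases p) auto
  show ?case
  proof (cases "j = i")
    case True
    then have "subtree (replace_tree x s (children t ! i)) q = Some (Assm A)"
      using Cons.prems(2) p i by simp
    from Cons.IH[OF i(2) this] show ?thesis using p True i by auto
  next
    case False
    then show ?thesis using Cons.prems(2) p by (auto split: if_splits)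
  qed
qed

lemma subtree_subst_tree:
  assumes "subtree (subst_tree U s t) p = Some (Assm A)"
  shows "(\<exists>x y B. p = x @ y \<and> subtree t x = Some (Assm B) \<and> U x \<and> subtree (s B) y = Some (Assm A))
    \<or> (subtree t p = Some (Assm A) \<and> \<not> U p)"
  using assms
proof (induction U s t arbitrary: p rule: subst_tree.induct)
  case (1 U s B)
  then show ?case
    by (cases "U []") (force dest: subtree_Assm intro: exI[of _ "[]"])+
next
  case (2 U s B ts)
  obtain i q where p: "p = i # q" using 2(2) by (cases p) auto
  then have i: "i < length ts" "subtree (subst_tree (\<lambda>p. U (i # p)) s (ts ! i)) q = Some (Assm A)"
    using 2(2) by (auto split: if_splits)
  have "(\<exists>x y B. q = x @ y \<and> subtree (ts ! i) x = Some (Assm B) \<and> U (i # x)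
        \<and> subtree (s B) y = Some (Assm A))
      \<or> (subtree (ts ! i) q = Some (Assm A) \<and> \<not> U (i # q))"
    using 2(1)[OF _ i(2)] i(1) by simp
  then show ?case
  proof (elim disjE exE conjE)
    fix x y C
    assume "q = x @ y" "subtree (ts ! i) x = Some (Assm C)" "U (i # x)"
      "subtree (s C) y = Some (Assm A)"
    then have "p = (i # x) @ y \<and> subtree (Inf B ts) (i # x) = Some (Assm C) \<and> U (i # x)
        \<and> subtree (s C) y = Some (Assm A)"
      using p i by simp
    then show ?thesis by blast
  qed (use p i in auto)
qed

lemma concl_inst:
  assumes "\<forall>A\<in>assms_of D. concl (\<sigma> A) = A"
  shows "concl (inst D \<sigma>) = concl D"
proof (cases "fst D")
  case (Assm A)
  then show ?thesis
  proof (cases "snd D [] = None")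
    case True
    then have "A \<in> assms_of D"
      using Assm by (auto simp: assms_of_def intro!: exI[of _ "[]"])
    then show ?thesis using assms Assm True by (simp add: concl_def inst_def)
  qed (auto simp: concl_def inst_def Assm)
qed (simp add: concl_def inst_def)

lemma find_SomeD: "find P xs = Some x \<Longrightarrow> x \<in> set xs \<and> P x"
  by (induction xs) (auto split: if_splits)

lemma closed_inst:
  assumes "\<forall>A\<in>assms_of D. closed_str (\<sigma> A)"
  shows "closed_str (inst D \<sigma>)"
  unfolding closed_str_def
proof (intro allI impI)
  fix p A
  assume "subtree (fst (inst D \<sigma>)) p = Some (Assm A)"
  then have "subtree (subst_tree (\<lambda>x. snd D x = None) (fst \<circ> \<sigma>) (fst D)) p = Some (Assm A)"
    by (simp add: inst_def)
  from subtree_subst_tree[OF this] show "p \<in> dom (snd (inst D \<sigma>))"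
  proof (elim disjE exE conjE)
    fix x y B
    assume p: "p = x @ y" and x: "subtree (fst D) x = Some (Assm B)" "snd D x = None"
      and y: "subtree ((fst \<circ> \<sigma>) B) y = Some (Assm A)"
    have "open_leaf D x" using x by (auto simp: open_leaf_def)
    then have "find (open_leaf D) (prefixes p) \<noteq> None"
      using p by (metis find_None_iff in_set_prefixes prefixI)
    then obtain x' where x': "find (open_leaf D) (prefixes p) = Some x'" by blast
    then have px': "prefix x' p" and ox': "open_leaf D x'" using find_SomeD[OF x'] by auto
    obtain C where C: "subtree (fst D) x' = Some (Assm C)" using ox' by (auto simp: open_leaf_def)
    have eq: "x' = x"
    proof -
      have "prefix x x' \<or> prefix x' x"
        using px' p prefix_same_cases[of x p x'] by auto
      then show ?thesis
      proof
        assume "prefix x x'"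
        then obtain z where "x' = x @ z" by (auto elim: prefixE)
        then show ?thesis using C x subtree_Assm[of B z] by (simp add: subtree_append)
      next
        assume "prefix x' x"
        then obtain z where "x = x' @ z" by (auto elim: prefixE)
        then show ?thesis using C x subtree_Assm[of C z] by (simp add: subtree_append)
      qed
    qed
    have "B \<in> assms_of D" using x by (auto simp: assms_of_def)
    then have "y \<in> dom (snd (\<sigma> B))" using assms y by (auto simp: closed_str_def)
    then show ?thesis using x' eq x p by (auto simp: inst_def)
  next
    assume x: "subtree (fst D) p = Some (Assm A)" "snd D p \<noteq> None"
    have "find (open_leaf D) (prefixes p) = None"
    proof (rule ccontr)
      assume "find (open_leaf D) (prefixes p) \<noteq> None"
      then obtain x' where x': "find (open_leaf D) (prefixes p) = Some x'" by blast
      then obtain C z where C: "subtree (fst D) x' = Some (Assm C)" "snd D x' = None" "p = x' @ z"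
        using find_SomeD[OF x'] by (auto simp: open_leaf_def elim: prefixE)
      then show False using x subtree_Assm[of C z] by (simp add: subtree_append)
    qed
    then show ?thesis using x by (auto simp: inst_def)
  qed
qed

lemma imm_reduces_invariant:
  assumes "reductions J" "imm_reduces J D D'" "closed_str D"
  shows "closed_str D' \<and> concl D' = concl D"
proof -
  obtain x \<phi> E where x: "subtree (fst D) x \<noteq> None" and \<phi>: "\<phi> \<in> J" "\<phi> (sub D x) = Some E"
    and r: "replacement D x E D'"
    using assms(2) unfolding imm_reduces_def by blast
  obtain R where "reduction_for R \<phi>" using assms(1) \<phi> by (auto simp: reductions_def)
  then obtain \<DD> where dom: "dom \<phi> = assoc ` \<DD>"
    and red: "\<forall>D \<in> assoc ` \<DD>. \<exists>\<Gamma>\<subseteq>assms_of D. from_to (the (\<phi> D)) \<Gamma> (concl D)"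
    by (auto simp: reduction_for_def)
  have "sub D x \<in> assoc ` \<DD>" using \<phi>(2) unfolding dom[symmetric] by (rule domI)
  then have E: "assms_of E \<subseteq> assms_of (sub D x)" "concl E = concl (sub D x)"
    using bspec[OF red, of "sub D x"] \<phi>(2) by (auto simp: from_to_def)
  obtain u where u: "subtree (fst D) x = Some u" using x by blast
  have tree: "fst D' = replace_tree x (fst E) (fst D)" using r by (simp add: replacement_def)
  have "concl D' = concl D"
    using label_replace_tree[OF u, of "fst E"] E(2) tree u by (simp add: concl_def sub_def)
  moreover have "closed_str D'"
    unfolding closed_str_def
  proof (intro allI impI)
    fix p A
    assume "subtree (fst D') p = Some (Assm A)"
    with tree have "subtree (replace_tree x (fst E) (fst D)) p = Some (Assm A)" by simp
    from subtree_replace_tree[OF x this] show "p \<in> dom (snd D')"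
    proof (elim disjE exE conjE)
      fix y
      assume p: "p = x @ y" and y: "subtree (fst E) y = Some (Assm A)"
      show ?thesis
      proof (cases "snd E y")
        case None
        then have "A \<in> assms_of (sub D x)" using y E(1) by (auto simp: assms_of_def)
        then obtain q where q: "subtree (fst (sub D x)) q = Some (Assm A)" "snd (sub D x) q = None"
          by (auto simp: assms_of_def)
        define M where "M = {snd D (x @ q) | q.
          item E y \<noteq> None \<and> item (sub D x) q = item E y \<and> snd (sub D x) q = None}"
        have "item E y = Some (AssmItem A)" "item (sub D x) q = Some (AssmItem A)"
          using y q by (auto simp: item_def)
        then have "snd D (x @ q) \<in> M" using q(2) unfolding M_def by fastforce
        moreover have "if M = {} then snd D' (x @ y) = None else snd D' (x @ y) \<in> M"
          using r None unfolding replacement_def M_def Let_def by blast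
        ultimately have "snd D' p \<in> M" using p by (auto split: if_splits)
        then obtain q' where q': "snd D' p = snd D (x @ q')" "item (sub D x) q' = Some (AssmItem A)"
          unfolding M_def using \<open>item E y = Some (AssmItem A)\<close> by auto
        have "subtree (fst (sub D x)) q' = Some (Assm A)"
          using q'(2) by (auto simp: item_def split: option.splits tree.splits if_splits)
        then have "subtree (fst D) (x @ q') = Some (Assm A)"
          using u by (simp add: sub_def subtree_append)
        then have "x @ q' \<in> dom (snd D)" using assms(3) unfolding closed_str_def by blast
        then show ?thesis using q'(1) by (simp add: domIff)
      next
        case (Some q)
        then show ?thesis using r p by (auto simp: replacement_def)
      qed
    next
      assume p: "\<not> prefix x p" "subtree (fst D) p = Some (Assm A)"
      then have "p \<in> dom (snd D)" using assms(3) unfolding closed_str_def by blast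
      then show ?thesis using r p(1) by (simp add: replacement_def domIff)
    qed
  qed
  ultimately show ?thesis by simp
qed

lemma reduces_invariant:
  assumes "reductions J" "reduces J D D'" "closed_str D"
  shows "closed_str D' \<and> concl D' = concl D"
  using assms(2,3) unfolding reduces_def
  by (induction rule: rtranclp_induct) (use imm_reduces_invariant[OF assms(1)] in auto)

definition val_measure :: "argstr \<Rightarrow> nat" where
  "val_measure D = 2 * (size (concl D) + (\<Sum>A\<in>assms_of D. size A)) + (if closed_str D then 0 else 1)"

lemma canonical_measure:
  assumes can: "canonical D" and cl: "closed_str D" and i: "i < length (children (fst D))"
  shows "val_measure (sub D [i]) < val_measure D"
proof -
  obtain Ds A \<delta> where I: "(Ds, A, \<delta>) \<in> and_intro \<union> or_intro \<union> imp_intro" and D: "D = (Inf A (map fst Ds), \<delta>)"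
    using can unfolding canonical_def by force
  have inf: "is_inference (Ds, A, \<delta>)" using I by (auto simp: and_intro_def or_intro_def imp_intro_def)
  have i': "i < length Ds" using i D by simp
  have sub: "sub D [i] = Ds ! i" using inf i' D by simp
  have vD: "val_measure D = 2 * size A" using cl D by (simp add: val_measure_def closed_str_iff concl_def)
  have leaf: "\<exists>x. \<delta> x = Some [] \<and> subtree (fst D) x = Some (Assm B)" if "B \<in> assms_of (Ds ! i)" for B
  proof -
    have "B \<in> assms_of (sub D [i])" using that sub by simp
    then obtain p where p: "subtree (fst (sub D [i])) p = Some (Assm B)" "snd (sub D [i]) p = None"
      by (auto simp: assms_of_def)
    have leafD: "subtree (fst D) (i # p) = Some (Assm B)" using p(1) i by (simp add: sub_def)
    then obtain q where q: "\<delta> (i # p) = Some q" using cl D unfolding closed_str_def by fastforce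
    then have "\<not> prefix [i] q" using p(2) D by (auto simp: sub_def split: if_splits)
    moreover have "strict_prefix q (i # p)"
      using inf q by (auto simp: arg_struct_def)
    ultimately have "q = []" by (cases q) auto
    then show ?thesis using q leafD by blast
  qed
  consider "(Ds, A, \<delta>) \<in> and_intro \<union> or_intro" | "(Ds, A, \<delta>) \<in> imp_intro" using I by blast
  then show ?thesis
  proof cases
    case 1
    then have "\<forall>x. \<delta> x \<noteq> Some []" by (auto simp: and_intro_def or_intro_def)
    then have "assms_of (Ds ! i) = {}" using leaf by blast
    moreover have "size (concl (Ds ! i)) < size A"
      using 1 i' by (auto simp: and_intro_def or_intro_def less_Suc_eq)
    ultimately show ?thesis using vD sub by (simp add: val_measure_def closed_str_iff)
  next
    case 2
    then obtain E B where E: "Ds = [E]" "A = Imp B (concl E)"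
      "\<forall>x. \<delta> x = Some [] \<longrightarrow> subtree (Inf A [fst E]) x = Some (Assm B)"
      by (auto simp: imp_intro_def)
    then have "assms_of (Ds ! i) \<subseteq> {B}" using leaf D by fastforce
    then have "(\<Sum>A\<in>assms_of (Ds ! i). size A) \<le> size B"
      by (metis empty_iff finite.emptyI finite_insert insert_iff le_refl sum.empty sum.insert
          add.right_neutral subset_singletonD zero_le)
    then show ?thesis using vD sub E i' by (auto simp: val_measure_def)
  qed
qed

declare conj_cong [fundef_cong]

text \<open>
  Validity on \<open>\<BB>\<close> of the argument \<open>(J, D)\<close>; the recursion is on the complexity of the conclusion and
  the undischarged assumptions.
\<close>
function valid :: "arule set \<Rightarrow> reduction set \<Rightarrow> argstr \<Rightarrow> bool" where
  "valid \<BB> J D \<longleftrightarrow> reductions J \<and>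
     (if closed_str D then
        if is_atomic (concl D) then (\<exists>D'. reduces J D D' \<and> D' \<in> DER \<BB>)
        else (\<exists>D'. reduces J D D' \<and> canonical D' \<and>
                (\<forall>i. i < length (children (fst D')) \<longrightarrow> valid \<BB> J (sub D' [i])))
      else (\<forall>\<sigma> J'. J \<subseteq> J' \<and> reductions J' \<and> assignment_for D \<sigma> \<longrightarrow>
              (\<forall>A. A \<in> assms_of D \<longrightarrow> closed_str (\<sigma> A) \<and> valid \<BB> J' (\<sigma> A)) \<longrightarrow>
              valid \<BB> J' (inst D \<sigma>)))"
  by pat_completeness auto
termination
proof (relation "Wellfounded.measure (\<lambda>(\<BB>, J, D). val_measure D)", goal_cases)
  case 1
  show ?case by simp
next
  case (2 \<BB> J D D' i)
  then show ?case
    using reduces_invariant[of J D D'] canonical_measure[of D' i]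
    by (simp add: val_measure_def closed_str_iff)
next
  case (3 \<BB> J D \<sigma> J' A)
  then have "concl (\<sigma> A) = A" by (simp add: assignment_for_def)
  moreover have "size A \<le> (\<Sum>A\<in>assms_of D. size A)"
    using 3 by (intro member_le_sum finite_assms_of) auto
  ultimately show ?case using 3 by (simp add: val_measure_def closed_str_iff)
next
  case (4 \<BB> J D \<sigma> J')
  then have "closed_str (inst D \<sigma>)" "concl (inst D \<sigma>) = concl D"
    by (auto intro!: closed_inst concl_inst simp: assignment_for_def)
  then show ?case using 4 by (simp add: val_measure_def closed_str_iff)
qed

declare valid.simps [simp del]

definition red_conseq :: "arule set \<Rightarrow> fm set \<Rightarrow> fm \<Rightarrow> bool" where
  "red_conseq \<BB> \<Gamma> A \<longleftrightarrow> (\<exists>D J. reductions J \<and> from_to D \<Gamma> A \<and> valid \<BB> J D)"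


definition IL_base_complete :: "(arule set \<Rightarrow> fm set \<Rightarrow> fm \<Rightarrow> bool) \<Rightarrow> bool" where
  "IL_base_complete conseq \<longleftrightarrow>
     (\<forall>\<Gamma> A \<BB>. finite \<Gamma> \<and> atomic_base \<BB> \<and> conseq \<BB> \<Gamma> A \<longrightarrow> il \<BB> \<Gamma> A)"

end

theory Submission
  imports Defs
begin

text \<open>
  One formula over one base separates all three relations from derivability: \<open>\<not> p\<close>, for a
  propositional variable \<open>p\<close>, over the empty base. The reason is that validity on a base does not
  look at extensions of the base, so that an implication is evaluated materially.

  Nothing is derivable from the empty base, in particular not \<open>p\<close>. Hence \<open>p \<rightarrow> \<bottom>\<close> has an
  invalid antecedent, and holds in the standard and in Sandqvist's semantics (which differ
  only on disjunctions). In the reducibility semantics the same thing happens one level up: a valid closed argument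
  for \<open>p\<close> would have to reduce to a derivation over the empty base, of which there is none. So the
  unjustified step from \<open>p\<close> to \<open>\<bottom>\<close> is vacuously valid, even without any reductions, and discharging
  \<open>p\<close> gives a valid canonical argument for \<open>\<not> p\<close>.

  On the other hand \<open>IL\<close> with the empty base is plain intuitionistic logic, which is sound for
  Boolean valuations; one that makes \<open>p\<close> true refutes \<open>\<not> p\<close>.
\<close>

abbreviation neg_var :: "nat \<Rightarrow> fm" where
  "neg_var n \<equiv> Imp (Atom (Var n)) (Atom Bot)"

lemma not_der_empty: "\<not> der {} a"
  by (auto elim: der.cases)

lemma atomic_base_empty: "atomic_base {}"
  by (simp add: atomic_base_def not_der_empty)

primrec bool_val :: "(nat \<Rightarrow> bool) \<Rightarrow> fm \<Rightarrow> bool" where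
  "bool_val v (Atom a) \<longleftrightarrow> (case a of Var n \<Rightarrow> v n | Bot \<Rightarrow> False)"
| "bool_val v (And A B) \<longleftrightarrow> bool_val v A \<and> bool_val v B"
| "bool_val v (Or A B) \<longleftrightarrow> bool_val v A \<or> bool_val v B"
| "bool_val v (Imp A B) \<longleftrightarrow> (bool_val v A \<longrightarrow> bool_val v B)"

text \<open>
  An atomic rule can become available only through the application of another one that discharges it,
  so over the empty base none is ever applied and the purely logical rules remain.
\<close>
lemma il_empty_bool_sound:
  assumes "il {} \<Gamma> A" "\<forall>B\<in>\<Gamma>. bool_val v B"
  shows "bool_val v A"
  using assms by (induction "{} :: arule set" \<Gamma> A rule: il.induct) auto

lemma not_il_neg_var: "\<not> il {} {} (neg_var n)"
  using il_empty_bool_sound[of "{}" "neg_var n" "\<lambda>_. True"] by auto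

text \<open>
  The rule applied at the root of a derivation cannot be discharged, there being no node below, so it
  has to come from the base.
\<close>
lemma DER_empty: "DER {} = {}"
proof -
  have "D \<notin> DER {}" for D
  proof
    assume "D \<in> DER {}"
    then obtain \<rho> where "\<forall>x t. subtree (fst D) x = Some t \<longrightarrow>
        (case snd D x of None \<Rightarrow> \<rho> x \<in> {}
         | Some y \<Rightarrow> (\<exists>i < length (prems (\<rho> y)).
             prefix (y @ [i]) x \<and> \<rho> x |\<in>| fst (prems (\<rho> y) ! i)))"
      unfolding DER_def by blast
    from this[rule_format, of "[]" "fst D"] show False
      by (auto split: option.splits)
  qed
  then show ?thesis by blast
qed

lemma not_valid_empty_atomic:
  "closed_str D \<Longrightarrow> is_atomic (concl D) \<Longrightarrow> \<not> valid {} J D"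
  by (subst valid.simps) (simp add: DER_empty)

text \<open>
  Validity of an open argument is a condition on its closed instances by valid arguments, and an atomic
  assumption admits no such instance over the empty base, whatever reductions are added.
\<close>
lemma valid_empty_from_atom:
  assumes "reductions J" "Atom a \<in> assms_of D"
  shows "valid {} J D"
proof -
  have "\<not> closed_str D"
    using assms(2) by (auto simp: closed_str_iff)
  moreover have "\<not> valid {} J' (\<sigma> (Atom a))"
    if "assignment_for D \<sigma>" "closed_str (\<sigma> (Atom a))" for \<sigma> J'
    using that assms(2)
    by (intro not_valid_empty_atomic) (auto simp: assignment_for_def is_atomic_def)
  ultimately show ?thesis
    using assms by (subst valid.simps) auto
qed

lemma subtree_Inf_singleton:
  "subtree (Inf A [t]) x = Some (Assm B) \<longleftrightarrow> (\<exists>y. x = 0 # y \<and> subtree t y = Some (Assm B))"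
  by (cases x) auto

lemma subtree_Assm_iff: "subtree (Assm A) x = Some (Assm B) \<longleftrightarrow> x = [] \<and> A = B"
  by (cases x) auto

definition absurd_step :: "fm \<Rightarrow> argstr" where
  "absurd_step A = (Inf (Atom Bot) [Assm A], Map.empty)"

text \<open>
  The leaf \<open>A\<close> of the unjustified step, now at position \<open>[0, 0]\<close>, is discharged at the root.
\<close>
definition absurd_intro :: "fm \<Rightarrow> argstr" where
  "absurd_intro A = (Inf (Imp A (Atom Bot)) [fst (absurd_step A)], [[0, 0] \<mapsto> []])"

lemma assms_absurd_step: "assms_of (absurd_step A) = {A}"
  by (auto simp: absurd_step_def assms_of_def subtree_Inf_singleton subtree_Assm_iff)

lemma from_to_absurd_intro: "from_to (absurd_intro A) {} (Imp A (Atom Bot))"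
  by (auto simp: from_to_def absurd_intro_def absurd_step_def assms_of_def subtree_Inf_singleton
      subtree_Assm_iff concl_def arg_struct_def item_def split: if_splits)

lemma sub_absurd_intro: "sub (absurd_intro A) [0] = absurd_step A"
  by (auto simp: sub_def absurd_intro_def absurd_step_def)

lemma canonical_absurd_intro: "canonical (absurd_intro A)"
proof -
  let ?I = "([absurd_step A], Imp A (concl (absurd_step A)), [[0, 0] \<mapsto> []])"
  have I: "assoc ?I = absurd_intro A"
    by (simp add: absurd_intro_def absurd_step_def concl_def)
  have "arg_struct (absurd_step A)"
    by (simp add: arg_struct_def absurd_step_def)
  moreover have "arg_struct (absurd_intro A)"
    using from_to_absurd_intro by (simp add: from_to_def)
  ultimately have "is_inference ?I"
    using I by (simp add: sub_absurd_intro del: assoc.simps)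
  then have "?I \<in> imp_intro"
    unfolding imp_intro_def
    by (auto simp: absurd_step_def split: if_splits simp del: is_inference.simps)
  then show ?thesis
    unfolding canonical_def using I by (metis UnI2)
qed

lemma red_conseq_neg_atom: "red_conseq {} {} (Imp (Atom a) (Atom Bot))"
proof -
  let ?D = "absurd_intro (Atom a)"
  have J: "reductions {}"
    by (simp add: reductions_def)
  have "valid {} {} (sub ?D [i])" if "i < length (children (fst ?D))" for i
  proof -
    have "i = 0"
      using that by (simp add: absurd_intro_def)
    then show ?thesis
      using J by (simp add: sub_absurd_intro valid_empty_from_atom assms_absurd_step)
  qed
  moreover have "reduces {} ?D ?D"
    by (simp add: reduces_def)
  ultimately have "\<exists>D'. reduces {} ?D D' \<and> canonical D' \<and>
      (\<forall>i. i < length (children (fst D')) \<longrightarrow> valid {} {} (sub D' [i]))"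
    using canonical_absurd_intro by blast
  moreover have "closed_str ?D" "\<not> is_atomic (concl ?D)"
    using from_to_absurd_intro[of "Atom a"]
    by (auto simp: closed_str_iff from_to_def is_atomic_def)
  ultimately have "valid {} {} ?D"
    using J by (subst valid.simps) simp
  then show ?thesis
    unfolding red_conseq_def using from_to_absurd_intro J by blast
qed

theorem corollary2:
  fixes conseq :: "arule set \<Rightarrow> fm set \<Rightarrow> fm \<Rightarrow> bool"
  assumes "conseq \<in> {std_conseq, red_conseq, sq_conseq}"
  shows "\<not> IL_base_complete conseq"
proof
  assume complete: "IL_base_complete conseq"
  have "std_conseq {} {} (neg_var 0)" "sq_conseq {} {} (neg_var 0)"
    by (simp_all add: std_conseq_def sq_conseq_def not_der_empty)
  with assms have "conseq {} {} (neg_var 0)"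
    using red_conseq_neg_atom by auto
  with complete have "il {} {} (neg_var 0)"
    using atomic_base_empty by (simp add: IL_base_complete_def)
  then show False
    by (simp add: not_il_neg_var)
qed

end
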